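(* Let $(X_1,d_1)$ and $(X_2,d_2)$ be quasi-metric spaces and let $\varphi:X_1\to X_2$ be an almost isometry. Then $\varphi$ is a homeomorphism when $X_1$ and $X_2$ are endowed with the topologies induced by $d_1$ and $d_2$ respectively. Moreover, any function $f:X_2\to\mathbb{R}$ for which $$d_2(\varphi(x),\varphi(y))=d_1(x,y)+f(\varphi(y))-f(\varphi(x))\quad\text{for all }x,y\in X_1$$ holds is continuous.
   Context: A quasi-metric on a set $X$ is a function $d:X\times X\to\mathbb{R}$ such that $d(x,y)\ge 0$ for all $x,y$, $d(x,y)=0$ if and only if $x=y$, and $d(x,y)+d(y,z)\ge d(x,z)$ for all $x,y,z$ (symmetry is not required). The topology induced by $d$ is the one generated by the sets $B_d^+(x,r)\cap B_d^-(x,r)$, $x\in X$, $r>0$, where $B_d^+(x,r)=\{y: d(x,y)<r\}$ and $B_d^-(x,r)=\{y: d(y,x)<r\}$; it coincides with the topology of the metric $\widetilde d(x,y)=\tfrac12(d(x,y)+d(y,x))$. The triangular function of $(X,d)$ is $T(x,y,z)=d(x,y)+d(y,z)-d(x,z)$. A bijection $\varphi:X_1\to X_2$ between quasi-metric spaces with triangular functions $T_1,T_2$ is an almost isometry if $T_2(\varphi(x),\varphi(y),\varphi(z))=T_1(x,y,z)$ for all $x,y,z\in X_1$. *)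

theory Defs
  imports "HOL-Analysis.Analysis"
begin

locale quasi_metric_space =
  fixes X :: "'a set" and d :: "'a \<Rightarrow> 'a \<Rightarrow> real"
  assumes nonneg: "\<lbrakk>x \<in> X; y \<in> X\<rbrakk> \<Longrightarrow> d x y \<ge> 0"
    and eq_zero_iff: "\<lbrakk>x \<in> X; y \<in> X\<rbrakk> \<Longrightarrow> d x y = 0 \<longleftrightarrow> x = y"
    and triangle: "\<lbrakk>x \<in> X; y \<in> X; z \<in> X\<rbrakk> \<Longrightarrow> d x y + d y z \<ge> d x z"

definition forward_ball :: "'a set \<Rightarrow> ('a \<Rightarrow> 'a \<Rightarrow> real) \<Rightarrow> 'a \<Rightarrow> real \<Rightarrow> 'a set" where
  "forward_ball X d x r = {y \<in> X. d x y < r}"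

definition backward_ball :: "'a set \<Rightarrow> ('a \<Rightarrow> 'a \<Rightarrow> real) \<Rightarrow> 'a \<Rightarrow> real \<Rightarrow> 'a set" where
  "backward_ball X d x r = {y \<in> X. d y x < r}"

definition qm_topology :: "'a set \<Rightarrow> ('a \<Rightarrow> 'a \<Rightarrow> real) \<Rightarrow> 'a topology" where
  "qm_topology X d = topology_generated_by
     {forward_ball X d x r \<inter> backward_ball X d x r | x r. x \<in> X \<and> r > 0}"

(* The underlying set of the generated topology, i.e. the union of the subbase, is all of X. *)
lemma (in quasi_metric_space) topspace_qm_topology: "topspace (qm_topology X d) = X"
proof -
  have "x \<in> forward_ball X d x 1 \<inter> backward_ball X d x 1" if "x \<in> X" for x
    using that eq_zero_iff[of x x] by (simp add: forward_ball_def backward_ball_def)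
  moreover have "(1::real) > 0" by simp
  ultimately have "X \<subseteq> \<Union>{forward_ball X d x r \<inter> backward_ball X d x r | x r. x \<in> X \<and> r > 0}"
    by blast
  then show ?thesis
    by (auto simp: qm_topology_def topology_generated_by_topspace forward_ball_def)
qed

definition triangular :: "('a \<Rightarrow> 'a \<Rightarrow> real) \<Rightarrow> 'a \<Rightarrow> 'a \<Rightarrow> 'a \<Rightarrow> real" where
  "triangular d x y z = d x y + d y z - d x z"

definition almost_isometry ::
  "'a set \<Rightarrow> ('a \<Rightarrow> 'a \<Rightarrow> real) \<Rightarrow> 'b set \<Rightarrow> ('b \<Rightarrow> 'b \<Rightarrow> real) \<Rightarrow> ('a \<Rightarrow> 'b) \<Rightarrow> bool" where
  "almost_isometry X1 d1 X2 d2 \<phi> \<longleftrightarrow>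
     bij_betw \<phi> X1 X2 \<and>
     (\<forall>x\<in>X1. \<forall>y\<in>X1. \<forall>z\<in>X1.
        triangular d2 (\<phi> x) (\<phi> y) (\<phi> z) = triangular d1 x y z)"

end

theory Submission
  imports Defs
begin

text \<open>
  A triangular function remembers the round-trip distance, because
  \<open>triangular d x y x = d x y + d y x - d x x\<close> and the last term vanishes. The round-trip distance
  is, up to the factor two, the metric that induces the topology of a quasi-metric space
  (\<open>qm_topology_eq_mtopology\<close>). An almost isometry is therefore an isometry for the round-trip
  metrics, and so is its inverse; both are continuous.

  A function \<open>f\<close> with \<open>d2 (\<phi> x) (\<phi> y) = d1 x y + f (\<phi> y) - f (\<phi> x)\<close> has increments that are
  differences of two nonnegative numbers, one of them a \<open>d2\<close>-distance and the other a \<open>d1\<close>-distance.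
  Each of these is at most the common round-trip distance, so \<open>f\<close> is 1-Lipschitz for
  the round-trip metric and hence continuous.
\<close>

text \<open>
  This is twice the usual symmetrization; dropping the factor makes it a value of the triangular
  function. The absolute value changes nothing on the carrier: it is there because
  \<open>Metric_space\<close> demands nonnegativity on the whole type, whereas a quasi-metric is
  constrained only on its carrier.
\<close>
definition round_trip :: "('a \<Rightarrow> 'a \<Rightarrow> real) \<Rightarrow> 'a \<Rightarrow> 'a \<Rightarrow> real" where
  "round_trip d x y = \<bar>d x y + d y x\<bar>"

context quasi_metric_space
begin

lemma round_trip_eq: "\<lbrakk>x \<in> X; y \<in> X\<rbrakk> \<Longrightarrow> round_trip d x y = d x y + d y x"
  using nonneg[of x y] nonneg[of y x] by (simp add: round_trip_def)

lemma round_trip_eq_triangular: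
  "\<lbrakk>x \<in> X; y \<in> X\<rbrakk> \<Longrightarrow> round_trip d x y = triangular d x y x"
  using eq_zero_iff[of x x] by (simp add: round_trip_eq triangular_def)

sublocale round_trip: Metric_space X "round_trip d"
proof
  fix x y z assume "x \<in> X" "y \<in> X"
  then show "round_trip d x y = 0 \<longleftrightarrow> x = y"
    using nonneg[of x y] nonneg[of y x] eq_zero_iff[of x y] eq_zero_iff[of y x]
    by (auto simp: round_trip_eq)
  assume "z \<in> X"
  with \<open>x \<in> X\<close> \<open>y \<in> X\<close> show "round_trip d x z \<le> round_trip d x y + round_trip d y z"
    using triangle[of x y z] triangle[of z y x] by (simp add: round_trip_eq)
qed (auto simp: round_trip_def)

text \<open>
  A round-trip ball of radius \<open>r\<close> sits inside the two-sided ball of radius \<open>r\<close>, and contains the one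
  of radius \<open>r / 2\<close>. The two-sided balls are open for the round-trip metric because the triangle
  inequality may be used once in each direction.
\<close>
lemma qm_topology_eq_mtopology: "qm_topology X d = round_trip.mtopology"
proof -
  let ?two_sided = "\<lambda>x r. forward_ball X d x r \<inter> backward_ball X d x r"
  let ?S = "{?two_sided x r | x r. x \<in> X \<and> r > 0}"
  have two_sided_open: "openin round_trip.mtopology (?two_sided x r)"
    if x: "x \<in> X" for x r
    unfolding round_trip.openin_mtopology
  proof (intro conjI allI impI)
    show "?two_sided x r \<subseteq> X"
      by (auto simp: forward_ball_def)
    fix y assume y: "y \<in> ?two_sided x r"
    \<comment> \<open>the slack of the tighter of the two constraints on \<open>y\<close>\<close>
    define e where "e = min (r - d x y) (r - d y x)"
    have "z \<in> ?two_sided x r" if "z \<in> round_trip.mball y e" for z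
      using that x y nonneg[of y z] nonneg[of z y] triangle[of x y z] triangle[of z y x]
      by (auto simp: e_def forward_ball_def backward_ball_def round_trip_eq)
    moreover have "e > 0"
      using y by (simp add: e_def forward_ball_def backward_ball_def)
    ultimately show "\<exists>e>0. round_trip.mball y e \<subseteq> ?two_sided x r"
      by blast
  qed
  have "openin (qm_topology X d) U \<longleftrightarrow> openin round_trip.mtopology U" for U
  proof
    assume "openin (qm_topology X d) U"
    then have "generate_topology_on ?S U"
      by (simp add: qm_topology_def openin_topology_generated_by_iff)
    then show "openin round_trip.mtopology U"
      by (rule generate_topology_on_coarsest[rotated 2]) (auto intro: two_sided_open)
  next
    assume U: "openin round_trip.mtopology U"
    show "openin (qm_topology X d) U"
    proof (subst openin_subopen, intro ballI)
      fix x assume "x \<in> U"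
      then have x: "x \<in> X"
        using U by (auto simp: round_trip.openin_mtopology)
      obtain r where r: "r > 0" "round_trip.mball x r \<subseteq> U"
        using U \<open>x \<in> U\<close> by (auto simp: round_trip.openin_mtopology)
      have "openin (qm_topology X d) (?two_sided x (r / 2))"
        unfolding qm_topology_def using x r by (intro topology_generated_by_Basis) force
      moreover have "x \<in> ?two_sided x (r / 2)"
        using x r eq_zero_iff[of x x] by (simp add: forward_ball_def backward_ball_def)
      moreover have "?two_sided x (r / 2) \<subseteq> round_trip.mball x r"
        using x by (auto simp: forward_ball_def backward_ball_def round_trip_eq)
      ultimately show "\<exists>T. openin (qm_topology X d) T \<and> x \<in> T \<and> T \<subseteq> U"
        using r by blast
    qed
  qed
  then show ?thesis
    by (simp add: topology_eq)
qed

text \<open>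
  The target is an arbitrary metric space because the same criterion serves twice: for maps into
  another quasi-metric space with its round-trip metric and for real-valued functions.
\<close>
lemma continuous_map_of_nonexpansive:
  assumes N: "Metric_space N e"
    and g: "g \<in> X \<rightarrow> N"
    and le: "\<And>x y. \<lbrakk>x \<in> X; y \<in> X\<rbrakk> \<Longrightarrow> e (g x) (g y) \<le> round_trip d x y"
  shows "continuous_map (qm_topology X d) (Metric_space.mtopology N e) g"
proof -
  interpret N: Metric_space N e by (rule N)
  show ?thesis
    unfolding qm_topology_eq_mtopology round_trip.metric_continuous_map[OF N]
    using g le by (blast intro: order.strict_trans1)
qed

end

lemma almost_isometry_round_trip:
  assumes "quasi_metric_space X1 d1" "quasi_metric_space X2 d2"
    and "almost_isometry X1 d1 X2 d2 \<phi>" "x \<in> X1" "y \<in> X1"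
  shows "round_trip d2 (\<phi> x) (\<phi> y) = round_trip d1 x y"
  using assms bij_betwE[of \<phi> X1 X2]
  by (simp add: quasi_metric_space.round_trip_eq_triangular almost_isometry_def)

theorem lemma2p10:
  fixes X1 :: "'a set" and d1 :: "'a \<Rightarrow> 'a \<Rightarrow> real"
    and X2 :: "'b set" and d2 :: "'b \<Rightarrow> 'b \<Rightarrow> real"
    and \<phi> :: "'a \<Rightarrow> 'b"
  assumes "quasi_metric_space X1 d1" and "quasi_metric_space X2 d2"
    and "almost_isometry X1 d1 X2 d2 \<phi>"
  shows "homeomorphic_map (qm_topology X1 d1) (qm_topology X2 d2) \<phi> \<and>
    (\<forall>f :: 'b \<Rightarrow> real.
      (\<forall>x\<in>X1. \<forall>y\<in>X1. d2 (\<phi> x) (\<phi> y) = d1 x y + f (\<phi> y) - f (\<phi> x)) \<longrightarrow>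
      continuous_map (qm_topology X2 d2) euclideanreal f)"
proof (intro conjI allI impI)
  interpret Q1: quasi_metric_space X1 d1 by fact
  interpret Q2: quasi_metric_space X2 d2 by fact
  note isometry = almost_isometry_round_trip[OF assms]
  define \<psi> where "\<psi> = inv_into X1 \<phi>"
  have bij: "bij_betw \<phi> X1 X2"
    using assms(3) by (simp add: almost_isometry_def)
  then have \<phi>: "\<phi> x \<in> X2" "\<psi> (\<phi> x) = x" if "x \<in> X1" for x
    using that by (auto simp: \<psi>_def bij_betwE bij_betw_inv_into_left)
  have \<psi>: "\<psi> u \<in> X1" "\<phi> (\<psi> u) = u" if "u \<in> X2" for u
    using that bij bij_betwE[OF bij_betw_inv_into[OF bij]]
    by (auto simp: \<psi>_def bij_betw_inv_into_right)
  have isometry_inv: "round_trip d1 (\<psi> u) (\<psi> v) = round_trip d2 u v"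
    if "u \<in> X2" "v \<in> X2" for u v
    using isometry[of "\<psi> u" "\<psi> v"] \<psi> that by simp
  have "continuous_map (qm_topology X1 d1) (qm_topology X2 d2) \<phi>"
    unfolding Q2.qm_topology_eq_mtopology
    by (rule Q1.continuous_map_of_nonexpansive[OF Q2.round_trip.Metric_space_axioms])
      (auto simp: \<phi> isometry)
  moreover have "continuous_map (qm_topology X2 d2) (qm_topology X1 d1) \<psi>"
    unfolding Q1.qm_topology_eq_mtopology
    by (rule Q2.continuous_map_of_nonexpansive[OF Q1.round_trip.Metric_space_axioms])
      (auto simp: \<psi> isometry_inv)
  ultimately have "homeomorphic_maps (qm_topology X1 d1) (qm_topology X2 d2) \<phi> \<psi>"
    by (simp add: homeomorphic_maps_def Q1.topspace_qm_topology Q2.topspace_qm_topology \<phi> \<psi>)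
  then show "homeomorphic_map (qm_topology X1 d1) (qm_topology X2 d2) \<phi>"
    by (rule homeomorphic_maps_imp_map)

  fix f :: "'b \<Rightarrow> real"
  assume f: "\<forall>x\<in>X1. \<forall>y\<in>X1. d2 (\<phi> x) (\<phi> y) = d1 x y + f (\<phi> y) - f (\<phi> x)"
  have "dist (f u) (f v) \<le> round_trip d2 u v" if uv: "u \<in> X2" "v \<in> X2" for u v
  proof -
    have increment: "f v - f u = d2 u v - d1 (\<psi> u) (\<psi> v)"
      using bspec[OF bspec[OF f \<psi>(1)[OF uv(1)]] \<psi>(1)[OF uv(2)]] \<psi>(2) uv by simp
    have "0 \<le> d2 u v" "d2 u v \<le> round_trip d2 u v"
      using Q2.nonneg uv by (auto simp: Q2.round_trip_eq)
    moreover have "0 \<le> d1 (\<psi> u) (\<psi> v)" "d1 (\<psi> u) (\<psi> v) \<le> round_trip d2 u v"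
      using Q1.nonneg \<psi>(1) uv by (auto simp: isometry_inv[symmetric] Q1.round_trip_eq)
    ultimately show ?thesis
      using increment by (simp add: dist_real_def)
  qed
  then have "continuous_map (qm_topology X2 d2) Met_TC.mtopology f"
    by (intro Q2.continuous_map_of_nonexpansive[OF Met_TC.Metric_space_axioms]) auto
  then show "continuous_map (qm_topology X2 d2) euclideanreal f"
    by simp
qed

end
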